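(* For the undirected greedy routing network creation game on any finite point set $\mathcal P\subset\mathbb R^2$ ($|\mathcal P|\ge2$) with the Euclidean metric, every pure Nash equilibrium $\mathbf s$ satisfies $c(\mathbf s)\le 1.8\cdot c(\mathbf s^* )$, where $\mathbf s^*$ is a social optimum. That is, the Price of Anarchy is at most $1.8$.
   Context: Undirected variant of the game: $\mathcal P$ is a finite set of points (agents) with metric $d$; each agent $u$ chooses a strategy $S_u\subseteq\{\{u,v\}:v\in\mathcal P\setminus\{u\}\}$ of undirected edges, which it owns; a profile $\mathbf s$ induces the network $G(\mathbf s)$ on $\mathcal P$ in which $\{u,v\}$ is an edge iff $\{u,v\}\in S_u\cup S_v$. A greedy routing path from $u$ to $w$ is a path $(x_1=u,\dots,x_j=w)$ in $G(\mathbf s)$ with $d(x_i,w)>d(x_{i+1},w)$ for all $i$; $u$ is greedy connected if it has a greedy routing path to every other agent. The cost of $u$ is $c_u(\mathbf s)=|S_u|$ if $u$ is greedy connected and $\infty$ otherwise; social cost $c(\mathbf s)=\sum_u c_u(\mathbf s)$. A pure Nash equilibrium is a profile where no agent can strictly decrease its cost by a unilateral deviation; a social optimum minimizes social cost. The Price of Anarchy is the worst-case ratio $c(\mathbf s)/c(\mathbf s^* )$ over Nash equilibria $\mathbf s$ (and instances). *)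

theory Defs
  imports "HOL-Analysis.Analysis"
begin

type_synonym point = "real^2"
type_synonym profile = "point \<Rightarrow> point set set"

definition strategies :: "point set \<Rightarrow> point \<Rightarrow> point set set set" where
  "strategies P u = Pow {{u, v} | v. v \<in> P - {u}}"

definition valid_profile :: "point set \<Rightarrow> profile \<Rightarrow> bool" where
  "valid_profile P s \<longleftrightarrow> (\<forall>u\<in>P. s u \<in> strategies P u)"

definition edge :: "point set \<Rightarrow> profile \<Rightarrow> point \<Rightarrow> point \<Rightarrow> bool" where
  "edge P s u v \<longleftrightarrow> u \<in> P \<and> v \<in> P \<and> {u, v} \<in> s u \<union> s v"

definition greedy_path :: "point set \<Rightarrow> profile \<Rightarrow> point list \<Rightarrow> point \<Rightarrow> point \<Rightarrow> bool" where
  "greedy_path P s xs u w \<longleftrightarrow> xs \<noteq> [] \<and> hd xs = u \<and> last xs = w \<and>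
     (\<forall>i. Suc i < length xs \<longrightarrow>
        edge P s (xs ! i) (xs ! Suc i) \<and> dist (xs ! i) w > dist (xs ! Suc i) w)"

definition greedy_connected :: "point set \<Rightarrow> profile \<Rightarrow> point \<Rightarrow> bool" where
  "greedy_connected P s u \<longleftrightarrow> (\<forall>w\<in>P - {u}. \<exists>xs. greedy_path P s xs u w)"

definition agent_cost :: "point set \<Rightarrow> profile \<Rightarrow> point \<Rightarrow> ereal" where
  "agent_cost P s u = (if greedy_connected P s u then ereal (real (card (s u))) else \<infinity>)"

definition social_cost :: "point set \<Rightarrow> profile \<Rightarrow> ereal" where
  "social_cost P s = (\<Sum>u\<in>P. agent_cost P s u)"

definition nash_equilibrium :: "point set \<Rightarrow> profile \<Rightarrow> bool" where
  "nash_equilibrium P s \<longleftrightarrow> valid_profile P s \<and>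
     (\<forall>u\<in>P. \<forall>S'\<in>strategies P u. agent_cost P s u \<le> agent_cost P (s(u := S')) u)"

definition social_optimum :: "point set \<Rightarrow> profile \<Rightarrow> bool" where
  "social_optimum P s \<longleftrightarrow> valid_profile P s \<and>
     (\<forall>s'. valid_profile P s' \<longrightarrow> social_cost P s \<le> social_cost P s')"

end

theory Submission
  imports Defs
begin

text \<open>Call an edge forced if one of its endpoints is a nearest neighbour of the other; every
  network in which all agents are greedy connected contains all forced edges. In an equilibrium,
  agent \<open>u\<close> owns at most \<open>|T| - i(u)\<close> edges whenever \<open>T\<close> contains all forced neighbours of \<open>u\<close> and,
  for every \<open>w\<close>, some point closer to \<open>w\<close> than \<open>u\<close>; here \<open>i(u)\<close> counts the forced edges at \<open>u\<close> owned
  by the other endpoint. Let \<open>m\<close> be the equilibrium cost and \<open>A\<close> the sum of the \<open>i(u)\<close>.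
  Taking for \<open>T\<close> the neighbourhood of \<open>u\<close> in the optimum yields \<open>m + A \<le> 2 c(s\<^sup>*)\<close>. Taking the forced
  neighbours together with a nearest point in each remaining sector of angle 60 degrees yields a
  \<open>T\<close> of size at most 5 times the number of forced neighbours, hence \<open>m + A \<le> 10 A\<close>. Together
  \<open>m \<le> 9/5 c(s\<^sup>*)\<close>.\<close>

section \<open>Hexagonal coordinates\<close>

text \<open>The squared norm of \<open>\<alpha> e + \<beta> f\<close> for unit vectors \<open>e\<close>, \<open>f\<close> enclosing 60 degrees.\<close>

definition hexq :: "real \<Rightarrow> real \<Rightarrow> real" where
  "hexq \<alpha> \<beta> = \<alpha>^2 + \<alpha> * \<beta> + \<beta>^2"

text \<open>Index of the half-open sector of angle 60 degrees containing \<open>\<alpha> e + \<beta> f\<close>; the origin gets the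
  junk value 5.\<close>

definition sector :: "real \<Rightarrow> real \<Rightarrow> nat" where
  "sector \<alpha> \<beta> =
     (if \<alpha> > 0 \<and> \<beta> \<ge> 0 then 0 else if \<alpha> \<le> 0 \<and> \<alpha> + \<beta> > 0 then 1
      else if \<beta> > 0 \<and> \<alpha> + \<beta> \<le> 0 then 2 else if \<alpha> < 0 \<and> \<beta> \<le> 0 then 3
      else if \<alpha> \<ge> 0 \<and> \<alpha> + \<beta> < 0 then 4 else 5)"

lemma hexq_diff_less_aligned:
  assumes "0 \<le> c" "c \<le> a" "0 \<le> d" "d \<le> b" "0 < c"
  shows "hexq (a - c) (b - d) < hexq a b"
proof -
  have "(a - c)^2 < a^2" using assms by (intro power_strict_mono) auto
  moreover have "(b - d)^2 \<le> b^2" using assms by (intro power_mono) auto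
  moreover have "(a - c) * (b - d) \<le> a * b" using assms by (intro mult_mono) auto
  ultimately show ?thesis unfolding hexq_def by linarith
qed

text \<open>The left side is \<open>hexq p (- q)\<close>: coordinate differences of opposite signs.
  The smaller of the two squares is at most \<open>p * q\<close>.\<close>

lemma hexq_opposite_le:
  fixes p q :: real
  assumes "0 \<le> p" "0 \<le> q"
  shows "p^2 - p * q + q^2 \<le> max (p^2) (q^2)"
proof (cases "p \<le> q")
  case True
  then have "p * p \<le> p * q" using assms by (intro mult_left_mono) auto
  then show ?thesis by (simp add: power2_eq_square)
next
  case False
  then have "q * q \<le> p * q" using assms by (intro mult_right_mono) auto
  then show ?thesis by (simp add: power2_eq_square)
qed

text \<open>Two vectors in a half-open 60 degree cone enclose less than 60 degrees, so the side
  joining their tips is shorter than the longer vector. The cases are the signs of the coordinate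
  differences; strictness in the mixed cases uses that the first coordinates are positive.\<close>

lemma hexq_cone:
  assumes "0 < a" "0 \<le> b" "0 < c" "0 \<le> d" and le: "hexq a b \<le> hexq c d"
  shows "hexq (a - c) (b - d) < hexq c d"
proof -
  have sym: "hexq (a - c) (b - d) = hexq (c - a) (d - b)"
    by (simp add: hexq_def power2_eq_square algebra_simps)
  have ab: "a^2 \<le> hexq a b" "b^2 < hexq a b" and cd: "c^2 \<le> hexq c d" "d^2 < hexq c d"
    using assms by (auto simp: hexq_def add_strict_increasing add_pos_nonneg)
  consider "c \<le> a" "d \<le> b" | "a \<le> c" "b \<le> d" | "c \<le> a" "b \<le> d" | "a \<le> c" "d \<le> b" by linarith
  then show ?thesis
  proof cases
    case 1
    then show ?thesis using hexq_diff_less_aligned[of c a d b] assms by linarith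
  next
    case 2
    then show ?thesis using hexq_diff_less_aligned[of a c b d] assms sym by linarith
  next
    case 3
    have "hexq (a - c) (b - d) \<le> max ((a - c)^2) ((d - b)^2)"
      using hexq_opposite_le[of "a - c" "d - b"] 3
      by (simp add: hexq_def power2_eq_square algebra_simps)
    moreover have "(a - c)^2 < a^2" using assms 3 by (intro power_strict_mono) auto
    moreover have "(d - b)^2 \<le> d^2" using assms 3 by (intro power_mono) auto
    ultimately show ?thesis using ab cd le by linarith
  next
    case 4
    have "hexq (a - c) (b - d) \<le> max ((c - a)^2) ((b - d)^2)"
      using hexq_opposite_le[of "c - a" "b - d"] 4
      by (simp add: hexq_def power2_eq_square algebra_simps)
    moreover have "(c - a)^2 < c^2" using assms 4 by (intro power_strict_mono) auto
    moreover have "(b - d)^2 \<le> b^2" using assms 4 by (intro power_mono) auto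
    ultimately show ?thesis using ab cd le by linarith
  qed
qed

text \<open>The six half-open cones cover the punctured plane, so away from the origin the default
  branch 5 is a genuine cone too.\<close>

lemma sector_cases:
  assumes "(\<alpha>, \<beta>) \<noteq> (0, 0)"
  shows "sector \<alpha> \<beta> = 0 \<and> \<alpha> > 0 \<and> \<beta> \<ge> 0 \<or> sector \<alpha> \<beta> = 1 \<and> \<alpha> \<le> 0 \<and> \<alpha> + \<beta> > 0
    \<or> sector \<alpha> \<beta> = 2 \<and> \<beta> > 0 \<and> \<alpha> + \<beta> \<le> 0 \<or> sector \<alpha> \<beta> = 3 \<and> \<alpha> < 0 \<and> \<beta> \<le> 0
    \<or> sector \<alpha> \<beta> = 4 \<and> \<alpha> \<ge> 0 \<and> \<alpha> + \<beta> < 0 \<or> sector \<alpha> \<beta> = 5 \<and> \<beta> < 0 \<and> \<alpha> + \<beta> \<ge> 0"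
proof -
  have "\<alpha> \<noteq> 0 \<or> \<beta> \<noteq> 0" using assms by simp
  then have "(\<alpha> > 0 \<and> \<beta> \<ge> 0) \<or> (\<alpha> \<le> 0 \<and> \<alpha> + \<beta> > 0) \<or> (\<beta> > 0 \<and> \<alpha> + \<beta> \<le> 0)
    \<or> (\<alpha> < 0 \<and> \<beta> \<le> 0) \<or> (\<alpha> \<ge> 0 \<and> \<alpha> + \<beta> < 0) \<or> (\<beta> < 0 \<and> \<alpha> + \<beta> \<ge> 0)"
    by linarith
  then show ?thesis unfolding sector_def by presburger
qed

text \<open>Rotation by -60 degrees maps \<open>(\<alpha>, \<beta>)\<close> to
  \<open>(\<alpha> + \<beta>, - \<alpha>)\<close> and preserves \<open>hexq\<close>; iterating it
  carries every sector to the first, where \<open>hexq_cone\<close> applies.\<close>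

lemma hexq_same_sector:
  assumes "(\<alpha>, \<beta>) \<noteq> (0, 0)" "(\<gamma>, \<delta>) \<noteq> (0, 0)"
    and "sector \<alpha> \<beta> = sector \<gamma> \<delta>" and le: "hexq \<alpha> \<beta> \<le> hexq \<gamma> \<delta>"
  shows "hexq (\<alpha> - \<gamma>) (\<beta> - \<delta>) < hexq \<gamma> \<delta>"
proof -
  consider "\<alpha> > 0" "\<beta> \<ge> 0" "\<gamma> > 0" "\<delta> \<ge> 0"
    | "\<alpha> \<le> 0" "\<alpha> + \<beta> > 0" "\<gamma> \<le> 0" "\<gamma> + \<delta> > 0"
    | "\<beta> > 0" "\<alpha> + \<beta> \<le> 0" "\<delta> > 0" "\<gamma> + \<delta> \<le> 0"
    | "\<alpha> < 0" "\<beta> \<le> 0" "\<gamma> < 0" "\<delta> \<le> 0"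
    | "\<alpha> \<ge> 0" "\<alpha> + \<beta> < 0" "\<gamma> \<ge> 0" "\<gamma> + \<delta> < 0"
    | "\<beta> < 0" "\<alpha> + \<beta> \<ge> 0" "\<delta> < 0" "\<gamma> + \<delta> \<ge> 0"
    using sector_cases[OF assms(1)] sector_cases[OF assms(2)] assms(3) by (elim disjE) simp_all
  then show ?thesis
  proof cases
    case 1
    then show ?thesis using hexq_cone le by blast
  next
    case 2
    then show ?thesis
      using hexq_cone[of "\<alpha> + \<beta>" "- \<alpha>" "\<gamma> + \<delta>" "- \<gamma>"] le
      by (simp add: hexq_def power2_eq_square algebra_simps)
  next
    case 3
    then show ?thesis
      using hexq_cone[of \<beta> "- \<alpha> - \<beta>" \<delta> "- \<gamma> - \<delta>"] le
      by (simp add: hexq_def power2_eq_square algebra_simps)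
  next
    case 4
    then show ?thesis
      using hexq_cone[of "- \<alpha>" "- \<beta>" "- \<gamma>" "- \<delta>"] le
      by (simp add: hexq_def power2_eq_square algebra_simps)
  next
    case 5
    then show ?thesis
      using hexq_cone[of "- \<alpha> - \<beta>" \<alpha> "- \<gamma> - \<delta>" \<gamma>] le
      by (simp add: hexq_def power2_eq_square algebra_simps)
  next
    case 6
    then show ?thesis
      using hexq_cone[of "- \<beta>" "\<alpha> + \<beta>" "- \<delta>" "\<gamma> + \<delta>"] le
      by (simp add: hexq_def power2_eq_square algebra_simps)
  qed
qed

text \<open>A point that is longer than the unit vector \<open>(1, 0)\<close> and not closer to it than to the origin
  makes an angle of more than 60 degrees with it.\<close>

lemma sector_far:
  assumes "hexq \<alpha> \<beta> > 1" "hexq (\<alpha> - 1) \<beta> \<ge> hexq \<alpha> \<beta>"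
  shows "sector \<alpha> \<beta> \<in> {1..4}"
proof -
  have le1: "2 * \<alpha> + \<beta> \<le> 1"
    using assms(2) by (simp add: hexq_def power2_eq_square algebra_simps)
  have "hexq \<alpha> \<beta> \<le> 1" if "(\<alpha> > 0 \<and> \<beta> \<ge> 0) \<or> (\<beta> \<le> 0 \<and> \<alpha> + \<beta> \<ge> 0)"
  proof -
    \<comment> \<open>The difference
      \<open>(2 * \<alpha> + \<beta>)^2 - hexq \<alpha> \<beta>\<close> is three times this
      product.\<close>
    have "0 \<le> \<alpha> * (\<alpha> + \<beta>)" using that by (intro mult_nonneg_nonneg) auto
    then have "hexq \<alpha> \<beta> \<le> (2 * \<alpha> + \<beta>)^2"
      by (simp add: hexq_def power2_eq_square algebra_simps)
    also have "\<dots> \<le> 1" using that le1 by (intro power_le_one) auto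
    finally show ?thesis .
  qed
  with assms(1) have "\<not> (\<alpha> > 0 \<and> \<beta> \<ge> 0)" "\<not> (\<beta> \<le> 0 \<and> \<alpha> + \<beta> \<ge> 0)" by linarith+
  then show ?thesis unfolding sector_def by auto
qed

lemma hexagonal_coordinates:
  fixes v :: "real^2"
  assumes "v \<noteq> 0"
  obtains a b :: "real^2 \<Rightarrow> real" where
    "\<And>x y. a (x - y) = a x - a y" "\<And>x y. b (x - y) = b x - b y"
    "\<And>x. (norm x)^2 = (norm v)^2 * hexq (a x) (b x)" "a v = 1" "b v = 0"
proof -
  define N where "N = (v$1)^2 + (v$2)^2"
  have sq: "(norm x)^2 = (x$1)^2 + (x$2)^2" for x :: "real^2"
    unfolding power2_norm_eq_inner by (simp add: inner_vec_def sum_2 power2_eq_square)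
  have N: "N \<noteq> 0" using assms sq[of v] by (auto simp: N_def)
  \<comment> \<open>These solve \<open>x = a x * v + b x * f\<close> for \<open>f\<close> the
    rotation of \<open>v\<close> by 60 degrees: the cross product with \<open>v\<close> isolates
    \<open>b\<close>, and the inner product with \<open>v\<close> then gives
    \<open>a\<close>.\<close>
  define b where "b x = 2 * (v$1 * x$2 - v$2 * x$1) / (sqrt 3 * N)" for x :: "real^2"
  define a where "a x = (v$1 * x$1 + v$2 * x$2) / N - b x / 2" for x :: "real^2"
  show thesis
  proof (rule that[of a b])
    fix x y :: "real^2"
    show "b (x - y) = b x - b y"
      by (simp add: b_def algebra_simps add_divide_distrib diff_divide_distrib)
    then show "a (x - y) = a x - a y"
      by (simp add: a_def algebra_simps add_divide_distrib diff_divide_distrib)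
    have "hexq (a x) (b x) = ((v$1 * x$1 + v$2 * x$2) / N)^2 + 3/4 * (b x)^2"
      by (simp add: hexq_def a_def power2_eq_square algebra_simps)
    also have "3/4 * (b x)^2 = ((v$1 * x$2 - v$2 * x$1) / N)^2"
      using N by (simp add: b_def power_divide power_mult_distrib del: right_diff_distrib_numeral)
    \<comment> \<open>Lagrange's identity: squared inner product plus squared cross product is the
      product of the squared norms.\<close>
    also have "((v$1 * x$1 + v$2 * x$2) / N)^2 + \<dots> = N * ((x$1)^2 + (x$2)^2) / N^2"
      by (simp add: N_def power_divide power2_eq_square algebra_simps add_divide_distrib diff_divide_distrib)
    finally show "(norm x)^2 = (norm v)^2 * hexq (a x) (b x)"
      using N by (simp add: sq flip: N_def) (simp add: power2_eq_square)
    show "b v = 0" by (simp add: b_def)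
    then show "a v = 1" using N by (simp add: a_def N_def power2_eq_square)
  qed
qed

section \<open>Small covers\<close>

text \<open>Greedy connectivity reduced to the first hop: from \<open>u\<close> a neighbour in
  \<open>T\<close> makes progress towards every target.\<close>

definition covers :: "point set \<Rightarrow> point \<Rightarrow> point set \<Rightarrow> bool" where
  "covers P u T \<longleftrightarrow> (\<forall>w\<in>P - {u}. \<exists>v\<in>T. dist v w < dist u w)"

definition nearest :: "point set \<Rightarrow> point \<Rightarrow> point \<Rightarrow> bool" where
  "nearest P u v \<longleftrightarrow> u \<in> P \<and> v \<in> P \<and> u \<noteq> v \<and> (\<forall>x\<in>P - {u}. dist u v \<le> dist u x)"

text \<open>All ties are included: every nearest neighbour counts, not just a chosen one.\<close>

definition forced :: "point set \<Rightarrow> point \<Rightarrow> point set" where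
  "forced P u = {v. nearest P u v \<or> nearest P v u}"

lemma forced_subset: "forced P u \<subseteq> P - {u}"
  by (auto simp: forced_def nearest_def)

lemma forced_sym: "v \<in> forced P u \<longleftrightarrow> u \<in> forced P v"
  by (auto simp: forced_def)

lemma nearest_exists:
  assumes "finite P" "card P \<ge> 2" "u \<in> P"
  obtains v where "nearest P u v"
proof -
  have ne: "P - {u} \<noteq> {}"
  proof
    assume "P - {u} = {}"
    then have "card P \<le> card {u}" by (intro card_mono) auto
    then show False using assms by simp
  qed
  then obtain v where "v \<in> P - {u}" "\<And>x. x \<in> P - {u} \<Longrightarrow> dist u v \<le> dist u x"
    using ex_min_if_finite[of "dist u ` (P - {u})"] assms(1)
    by (metis (no_types, lifting) arg_min_if_finite(1) arg_min_least finite_Diff)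
  then show thesis using that assms(3) by (auto simp: nearest_def)
qed

text \<open>One point nearest to \<open>w\<close> is picked from each occupied class. A
  representative covers itself, by \<open>close\<close> with \<open>x = y\<close>.\<close>

lemma cover_from_classes:
  fixes \<sigma> :: "point \<Rightarrow> nat"
  assumes "finite U" "finite I" "\<sigma> ` U \<subseteq> I"
    and close: "\<And>x y. x \<in> U \<Longrightarrow> y \<in> U \<Longrightarrow> \<sigma> x = \<sigma> y \<Longrightarrow> dist w x \<le> dist w y \<Longrightarrow> dist x y < dist w y"
  obtains X where "X \<subseteq> U" "card X \<le> card I" "\<And>y. y \<in> U \<Longrightarrow> \<exists>x\<in>X. dist x y < dist w y"
proof -
  define g where "g i = arg_min_on (dist w) {x \<in> U. \<sigma> x = i}" for i
  have g: "g (\<sigma> y) \<in> U" "\<sigma> (g (\<sigma> y)) = \<sigma> y" "dist w (g (\<sigma> y)) \<le> dist w y" if "y \<in> U" for y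
    using arg_min_if_finite(1)[of "{x \<in> U. \<sigma> x = \<sigma> y}" "dist w"]
      arg_min_least[of "{x \<in> U. \<sigma> x = \<sigma> y}" y "dist w"] assms(1) that
    by (auto simp: g_def)
  show thesis
  proof
    show "g ` \<sigma> ` U \<subseteq> U" using g by auto
    show "card (g ` \<sigma> ` U) \<le> card I"
      using assms by (meson card_image_le card_mono finite_imageI order_trans)
    show "\<exists>x\<in>g ` \<sigma> ` U. dist x y < dist w y" if "y \<in> U" for y
      using g[OF that] close that by blast
  qed
qed

lemma small_cover:
  assumes "finite P" "card P \<ge> 2" "w \<in> P"
  obtains T where "forced P w \<subseteq> T" "T \<subseteq> P - {w}" "covers P w T" "card T \<le> 5 * card (forced P w)"
proof -
  obtain v where v: "nearest P w v" using nearest_exists assms by blast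
  then have vF: "v \<in> forced P w" by (simp add: forced_def)
  have finF: "finite (forced P w)" using forced_subset assms(1) by (meson finite_Diff finite_subset)
  have "v - w \<noteq> 0" using v by (auto simp: nearest_def)
  then obtain a b where lin: "\<And>x y. a (x - y) = a x - a y" "\<And>x y. b (x - y) = b x - b y"
    and nrm: "\<And>x. (norm x)^2 = (norm (v - w))^2 * hexq (a x) (b x)"
    and av: "a (v - w) = 1" "b (v - w) = 0"
    by (rule hexagonal_coordinates) blast
  define r where "r = (norm (v - w))^2"
  have r: "r > 0" using \<open>v - w \<noteq> 0\<close> by (simp add: r_def)
  define q where "q x = hexq (a x) (b x)" for x
  define \<sigma> where "\<sigma> x = sector (a (x - w)) (b (x - w))" for x
  have dist_q: "(dist x y)^2 = r * q (x - y)" for x y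
    using nrm[of "x - y"] by (simp only: dist_norm r_def q_def)
  have dist_le: "dist x y \<le> dist x' y' \<longleftrightarrow> q (x - y) \<le> q (x' - y')" for x y x' y'
  proof -
    have "dist x y \<le> dist x' y' \<longleftrightarrow> (dist x y)^2 \<le> (dist x' y')^2" by (simp add: power_mono_iff)
    also have "\<dots> \<longleftrightarrow> q (x - y) \<le> q (x' - y')" unfolding dist_q using r by simp
    finally show ?thesis .
  qed
  have dist_less: "dist x y < dist x' y' \<longleftrightarrow> q (x - y) < q (x' - y')" for x y x' y'
    by (simp only: not_le[symmetric] dist_le)
  have close: "dist x y < dist w y" if "x \<noteq> w" "y \<noteq> w" "\<sigma> x = \<sigma> y" "dist w x \<le> dist w y" for x y
  proof -
    have nz: "(a (z - w), b (z - w)) \<noteq> (0, 0)" if "z \<noteq> w" for z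
      using nrm[of "z - w"] that by (auto simp: hexq_def)
    have "dist x w \<le> dist y w" using that by (simp add: dist_commute)
    then have "hexq (a (x - w)) (b (x - w)) \<le> hexq (a (y - w)) (b (y - w))"
      by (simp add: dist_le q_def)
    from hexq_same_sector[OF nz nz _ this] that have "q (x - y) < q (y - w)"
      by (simp add: \<sigma>_def q_def lin)
    then have "dist x y < dist y w" by (simp add: dist_less)
    then show ?thesis by (simp add: dist_commute)
  qed
  define U where "U = {x \<in> P - {w}. \<forall>f\<in>forced P w. \<not> dist f x < dist w x}"
  \<comment> \<open>With \<open>k\<close> forced neighbours, \<open>k \<ge> 2\<close> leaves room
    for all six sectors since \<open>k + 6 \<le> 5 * k\<close>. For \<open>k = 1\<close> only four
    sectors are affordable; the two adjacent to the direction of \<open>v\<close> must contain no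
    point of \<open>U\<close>.\<close>
  define I :: "nat set" where "I = (if card (forced P w) \<ge> 2 then {0..5} else {1..4})"
  have "\<sigma> ` U \<subseteq> I"
  proof (cases "card (forced P w) \<ge> 2")
    case True
    then show ?thesis by (auto simp: I_def \<sigma>_def sector_def)
  next
    case False
    have F: "forced P w = {v}"
    proof -
      have "card (forced P w) = 1" using False vF finF card_0_eq by fastforce
      then show ?thesis using vF by (metis card_1_singletonE singletonD)
    qed
    have "\<sigma> x \<in> {1..4}" if x: "x \<in> U" for x
    proof -
      have xP: "x \<in> P - {w}" and nc: "dist w x \<le> dist v x" using x vF by (auto simp: U_def)
      have "x \<noteq> v" using nc xP by auto
      \<comment> \<open>As \<open>v\<close> is the only forced neighbour, no other point ties with
        it, which gives the strict inequality that \<open>sector_far\<close> needs.\<close>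
      then have "\<not> nearest P w x" using F by (auto simp: forced_def)
      then have "dist w v < dist w x"
        using v xP unfolding nearest_def by (metis DiffE insertI1 order.trans not_le)
      then have "dist v w < dist x w" by (simp add: dist_commute)
      then have "hexq (a (x - w)) (b (x - w)) > 1"
        by (simp add: dist_less q_def av) (simp add: hexq_def)
      moreover have "dist x w \<le> dist x v" using nc by (simp add: dist_commute)
      then have "hexq (a (x - w)) (b (x - w)) \<le> hexq (a (x - v)) (b (x - v))"
        by (simp add: dist_le q_def)
      moreover have "a (x - v) = a (x - w) - 1" "b (x - v) = b (x - w)"
        using av by (simp_all add: lin)
      ultimately show ?thesis unfolding \<sigma>_def by (intro sector_far) simp_all
    qed
    then show ?thesis using False by (auto simp: I_def)
  qed
  moreover have "finite U" using assms by (simp add: U_def)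
  moreover have "finite I" by (simp add: I_def)
  moreover have "dist x y < dist w y"
    if "x \<in> U" "y \<in> U" "\<sigma> x = \<sigma> y" "dist w x \<le> dist w y" for x y
    using close[of x y] that by (simp add: U_def)
  ultimately obtain X where X: "X \<subseteq> U" "card X \<le> card I"
    "\<And>y. y \<in> U \<Longrightarrow> \<exists>x\<in>X. dist x y < dist w y"
    using cover_from_classes[of U I \<sigma> w thesis] by blast
  show thesis
  proof
    show "forced P w \<subseteq> forced P w \<union> X" by simp
    show "forced P w \<union> X \<subseteq> P - {w}" using forced_subset X(1) by (auto simp: U_def)
    show "covers P w (forced P w \<union> X)"
      unfolding covers_def
    proof
      fix y assume "y \<in> P - {w}"
      then show "\<exists>x\<in>forced P w \<union> X. dist x y < dist w y"
        using X(3)[of y] by (cases "y \<in> U") (auto simp: U_def)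
    qed
    have "card (forced P w) \<ge> 1" using vF finF by (metis One_nat_def Suc_leI card_gt_0_iff empty_iff)
    then show "card (forced P w \<union> X) \<le> 5 * card (forced P w)"
      using card_Un_le[of "forced P w" X] X(2) by (auto simp: I_def split: if_splits)
  qed
qed

section \<open>Greedy connectivity\<close>

lemma edge_sym: "edge P s u v \<longleftrightarrow> edge P s v u"
  by (auto simp: edge_def insert_commute)

lemma greedy_path_dist_le:
  assumes "greedy_path P s xs u w" "i < length xs"
  shows "dist (xs ! i) w \<le> dist u w"
  using assms(2)
proof (induction i)
  case 0
  then show ?case using assms(1) by (auto simp: greedy_path_def hd_conv_nth)
next
  case (Suc i)
  then have "dist (xs ! Suc i) w < dist (xs ! i) w" using assms(1) by (auto simp: greedy_path_def)
  then show ?case using Suc by simp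
qed

lemma greedy_connected_covers:
  assumes "greedy_connected P s u"
  shows "covers P u {v. edge P s u v}"
  unfolding covers_def
proof
  fix w assume w: "w \<in> P - {u}"
  then obtain xs where xs: "greedy_path P s xs u w" using assms by (auto simp: greedy_connected_def)
  then have "Suc 0 < length xs"
    using w unfolding greedy_path_def
    by (metis DiffD2 One_nat_def Suc_lessI diff_Suc_1 hd_conv_nth insertI1 last_conv_nth length_greater_0_conv)
  then have "edge P s (xs ! 0) (xs ! 1)" "dist (xs ! 0) w > dist (xs ! 1) w" "xs ! 0 = u"
    using xs by (auto simp: greedy_path_def hd_conv_nth)
  then show "\<exists>v\<in>{v. edge P s u v}. dist v w < dist u w" by auto
qed

text \<open>If \<open>v\<close> is nearest to \<open>u\<close>, the first greedy hop from
  \<open>v\<close> towards \<open>u\<close> must land closer to \<open>u\<close> than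
  \<open>v\<close>, and only \<open>u\<close> itself is.\<close>

lemma forced_edge:
  assumes "\<And>u. u \<in> P \<Longrightarrow> greedy_connected P s u" and "v \<in> forced P u"
  shows "edge P s u v"
proof -
  have *: "edge P s v u" if "nearest P u v" for u v
  proof -
    have "u \<in> P - {v}" "v \<in> P" using that by (auto simp: nearest_def)
    then obtain x where x: "edge P s v x" "dist x u < dist v u"
      using greedy_connected_covers[OF assms(1)] by (auto simp: covers_def)
    then have "x \<in> P" by (simp add: edge_def)
    then have "x = u" using x that unfolding nearest_def by (metis DiffI dist_commute not_le singletonD)
    then show ?thesis using x by simp
  qed
  then show ?thesis using assms(2) edge_sym unfolding forced_def by blast
qed

text \<open>After the first hop, a greedy path towards \<open>w\<close> stays closer to \<open>w\<close> than \<open>u\<close>, so it never uses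
  an edge at \<open>u\<close> and survives the deviation of \<open>u\<close>.\<close>

lemma greedy_connected_deviation:
  assumes conn: "\<And>v. v \<in> P \<Longrightarrow> greedy_connected P s v" and u: "u \<in> P"
    and cov: "covers P u {v. edge P (s(u := S')) u v}"
  shows "greedy_connected P (s(u := S')) u"
  unfolding greedy_connected_def
proof
  fix w assume w: "w \<in> P - {u}"
  then obtain v where v: "edge P (s(u := S')) u v" "dist v w < dist u w"
    using cov by (auto simp: covers_def)
  have vP: "v \<in> P" using v by (simp add: edge_def)
  obtain xs where xs: "greedy_path P s xs v w"
  proof (cases "v = w")
    case True
    then have "greedy_path P s [w] v w" by (simp add: greedy_path_def)
    then show ?thesis using that by blast
  next
    case False
    then show ?thesis using conn[OF vP] w that by (auto simp: greedy_connected_def)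
  qed
  have ne: "xs ! i \<noteq> u" if "i < length xs" for i
    using greedy_path_dist_le[OF xs that] v by auto
  have "greedy_path P (s(u := S')) (u # xs) u w"
    unfolding greedy_path_def
  proof (intro conjI allI impI)
    show "last (u # xs) = w" using xs by (auto simp: greedy_path_def)
    fix i assume i: "Suc i < length (u # xs)"
    have "edge P (s(u := S')) ((u # xs) ! i) ((u # xs) ! Suc i) \<and>
      dist ((u # xs) ! Suc i) w < dist ((u # xs) ! i) w"
    proof (cases i)
      case 0
      then show ?thesis using v xs by (auto simp: greedy_path_def hd_conv_nth)
    next
      case (Suc j)
      then have "edge P s (xs ! j) (xs ! Suc j)" "dist (xs ! Suc j) w < dist (xs ! j) w"
        using xs i by (auto simp: greedy_path_def)
      then show ?thesis using ne[of j] ne[of "Suc j"] Suc i by (auto simp: edge_def)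
    qed
    then show "edge P (s(u := S')) ((u # xs) ! i) ((u # xs) ! Suc i)"
      "dist ((u # xs) ! Suc i) w < dist ((u # xs) ! i) w" by auto
  qed auto
  then show "\<exists>xs. greedy_path P (s(u := S')) xs u w" by blast
qed

section \<open>Equilibria\<close>

text \<open>Buying every possible edge has finite cost, so no agent has infinite cost in an
  equilibrium.\<close>

lemma nash_greedy_connected:
  assumes nash: "nash_equilibrium P s" and u: "u \<in> P"
  shows "greedy_connected P s u"
proof -
  define S where "S = {{u, v} | v. v \<in> P - {u}}"
  have "greedy_path P (s(u := S)) [u, w] u w" if "w \<in> P - {u}" for w
    using that u by (auto simp: greedy_path_def edge_def S_def less_Suc_eq)
  then have "greedy_connected P (s(u := S)) u" by (auto simp: greedy_connected_def)
  moreover have "agent_cost P s u \<le> agent_cost P (s(u := S)) u"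
    using nash u by (auto simp: nash_equilibrium_def strategies_def S_def)
  ultimately show ?thesis by (auto simp: agent_cost_def split: if_splits)
qed

lemma inj_on_edges: "inj_on (\<lambda>v. {u, v}) A"
  by (auto simp: inj_on_def doubleton_eq_iff)

text \<open>The deviation connects \<open>u\<close> to all of \<open>T\<close> but pays only for
  edges that the other endpoint does not already own. This saves at least the incoming edges from
  \<open>F\<close>.\<close>

lemma nash_card_le:
  assumes fin: "finite P" and nash: "nash_equilibrium P s" and u: "u \<in> P"
    and T: "T \<subseteq> P - {u}" "covers P u T" and F: "F \<subseteq> T"
  shows "card (s u) + card {v \<in> F. {u, v} \<in> s v} \<le> card T"
proof -
  define I where "I = {v. {u, v} \<in> s v}"
  define S where "S = (\<lambda>v. {u, v}) ` (T - I)"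
  have finT: "finite T" using T fin by (meson finite_Diff finite_subset)
  have S: "S \<in> strategies P u" using T by (auto simp: S_def strategies_def)
  have "T \<subseteq> {v. edge P (s(u := S)) u v}"
    using T u by (auto simp: edge_def S_def I_def)
  then have "covers P u {v. edge P (s(u := S)) u v}" using T(2) unfolding covers_def by blast
  then have "greedy_connected P (s(u := S)) u"
    using greedy_connected_deviation nash_greedy_connected[OF nash] u by blast
  moreover have "agent_cost P s u \<le> agent_cost P (s(u := S)) u"
    using nash u S by (auto simp: nash_equilibrium_def)
  ultimately have "card (s u) \<le> card S"
    using nash_greedy_connected[OF nash u] by (simp add: agent_cost_def)
  also have "\<dots> = card (T - I)" by (simp add: S_def card_image inj_on_edges)
  finally have "card (s u) + card (F \<inter> I) \<le> card (T - I) + card (T \<inter> I)"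
    using card_mono[of "T \<inter> I" "F \<inter> I"] finT F by (meson Int_mono add_mono finite_Int subset_refl)
  also have "\<dots> = card T"
    using finT by (metis add.commute card_Int_Diff)
  finally show ?thesis by (simp add: I_def Int_def)
qed

section \<open>Double counting of edges and owners\<close>

lemma sum_card_swap:
  assumes "finite P"
  shows "(\<Sum>u\<in>P. card {v \<in> P. R u v}) = (\<Sum>u\<in>P. card {v \<in> P. R v u})"
proof -
  have card_eq: "card {v \<in> P. Q v} = (\<Sum>v\<in>P. if Q v then 1 else 0)" for Q
    using assms by (simp add: sum.If_cases Int_def)
  show ?thesis unfolding card_eq by (rule sum.swap)
qed

text \<open>Each neighbour is joined by an owned or an incoming edge, and in total there are as many
  incoming as owned ones. An edge with two owners is paid twice, hence only an inequality.\<close>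

lemma sum_degree_le:
  assumes fin: "finite P" and "valid_profile P s"
  shows "(\<Sum>u\<in>P. card {v. edge P s u v}) \<le> 2 * (\<Sum>u\<in>P. card (s u))"
proof -
  have "(\<Sum>u\<in>P. card {v. edge P s u v})
      \<le> (\<Sum>u\<in>P. card {v \<in> P. {u, v} \<in> s u} + card {v \<in> P. {u, v} \<in> s v})"
  proof (rule sum_mono)
    fix u
    have "{v. edge P s u v} \<subseteq> {v \<in> P. {u, v} \<in> s u} \<union> {v \<in> P. {u, v} \<in> s v}"
      by (auto simp: edge_def)
    then have "card {v. edge P s u v} \<le> card ({v \<in> P. {u, v} \<in> s u} \<union> {v \<in> P. {u, v} \<in> s v})"
      using fin by (intro card_mono) auto
    then show "card {v. edge P s u v} \<le> card {v \<in> P. {u, v} \<in> s u} + card {v \<in> P. {u, v} \<in> s v}"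
      using card_Un_le order_trans by blast
  qed
  also have "\<dots> = 2 * (\<Sum>u\<in>P. card {v \<in> P. {u, v} \<in> s u})"
    using sum_card_swap[OF fin, of "\<lambda>u v. {u, v} \<in> s v"]
    by (simp add: sum.distrib insert_commute)
  also have "(\<Sum>u\<in>P. card {v \<in> P. {u, v} \<in> s u}) \<le> (\<Sum>u\<in>P. card (s u))"
  proof (rule sum_mono)
    fix u assume u: "u \<in> P"
    then have "s u \<subseteq> (\<lambda>v. {u, v}) ` P"
      using assms(2) by (auto simp: valid_profile_def strategies_def)
    then have "finite (s u)" using fin by (meson finite_imageI finite_subset)
    then show "card {v \<in> P. {u, v} \<in> s u} \<le> card (s u)"
      by (intro card_inj_on_le[of "\<lambda>v. {u, v}"]) (auto intro: inj_on_edges)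
  qed
  finally show ?thesis by simp
qed

lemma edge_neighbours_subset:
  assumes "valid_profile P s" "u \<in> P"
  shows "{v. edge P s u v} \<subseteq> P - {u}"
  using assms by (auto simp: edge_def valid_profile_def strategies_def doubleton_eq_iff)

lemma nash_sum_card_le:
  assumes fin: "finite P" and card: "card P \<ge> 2" and nash: "nash_equilibrium P s"
    and valid: "valid_profile P s'" and conn: "\<And>u. u \<in> P \<Longrightarrow> greedy_connected P s' u"
  shows "5 * (\<Sum>u\<in>P. card (s u)) \<le> 9 * (\<Sum>u\<in>P. card (s' u))"
proof -
  \<comment> \<open>\<open>A\<close> counts pairs of a forced edge and an owner of it, each recorded
    at the non-owning end of the pair.\<close>
  define A where "A = (\<Sum>u\<in>P. card {v \<in> forced P u. {u, v} \<in> s v})"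
  have "(\<Sum>u\<in>P. card (s u)) + A \<le> (\<Sum>u\<in>P. card {v. edge P s' u v})"
    unfolding A_def sum.distrib[symmetric]
  proof (rule sum_mono)
    fix u assume u: "u \<in> P"
    have "forced P u \<subseteq> {v. edge P s' u v}" using forced_edge conn by blast
    then show "card (s u) + card {v \<in> forced P u. {u, v} \<in> s v} \<le> card {v. edge P s' u v}"
      using nash_card_le[OF fin nash u] edge_neighbours_subset[OF valid u]
        greedy_connected_covers[OF conn[OF u]] by blast
  qed
  also have "\<dots> \<le> 2 * (\<Sum>u\<in>P. card (s' u))" by (rule sum_degree_le[OF fin valid])
  finally have opt: "(\<Sum>u\<in>P. card (s u)) + A \<le> 2 * (\<Sum>u\<in>P. card (s' u))" .
  have "(\<Sum>u\<in>P. card (s u)) + A \<le> (\<Sum>u\<in>P. 5 * card (forced P u))"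
    unfolding A_def sum.distrib[symmetric]
  proof (rule sum_mono)
    fix u assume u: "u \<in> P"
    obtain T where "forced P u \<subseteq> T" "T \<subseteq> P - {u}" "covers P u T" "card T \<le> 5 * card (forced P u)"
      using small_cover[OF fin card u] .
    then show "card (s u) + card {v \<in> forced P u. {u, v} \<in> s v} \<le> 5 * card (forced P u)"
      using nash_card_le[OF fin nash u] order_trans by blast
  qed
  also have "\<dots> = 5 * (\<Sum>u\<in>P. card (forced P u))" by (simp add: sum_distrib_left)
  \<comment> \<open>A forced edge contributes 2 to the left sum, one per endpoint, and has at least
    one owner in the equilibrium.\<close>
  also have "(\<Sum>u\<in>P. card (forced P u)) \<le> 2 * A"
  proof -
    have "(\<Sum>u\<in>P. card (forced P u))
        \<le> (\<Sum>u\<in>P. card {v \<in> P. v \<in> forced P u \<and> {u, v} \<in> s u}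
            + card {v \<in> P. v \<in> forced P u \<and> {u, v} \<in> s v})"
    proof (rule sum_mono)
      fix u
      have "forced P u \<subseteq> {v \<in> P. v \<in> forced P u \<and> {u, v} \<in> s u}
          \<union> {v \<in> P. v \<in> forced P u \<and> {u, v} \<in> s v}"
        using forced_edge[OF nash_greedy_connected[OF nash]] by (auto simp: edge_def)
      then have "card (forced P u) \<le> card ({v \<in> P. v \<in> forced P u \<and> {u, v} \<in> s u}
          \<union> {v \<in> P. v \<in> forced P u \<and> {u, v} \<in> s v})"
        using fin by (intro card_mono) auto
      then show "card (forced P u) \<le> card {v \<in> P. v \<in> forced P u \<and> {u, v} \<in> s u}
          + card {v \<in> P. v \<in> forced P u \<and> {u, v} \<in> s v}"
        using card_Un_le order_trans by blast
    qed
    also have "\<dots> = 2 * (\<Sum>u\<in>P. card {v \<in> P. v \<in> forced P u \<and> {u, v} \<in> s v})"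
      using sum_card_swap[OF fin, of "\<lambda>u v. v \<in> forced P u \<and> {u, v} \<in> s u"]
      by (simp add: sum.distrib insert_commute forced_sym[of _ P])
    also have "\<dots> = 2 * A"
      unfolding A_def using forced_subset by (intro arg_cong[where f = "(*) 2"] sum.cong arg_cong[where f = card]) auto
    finally show ?thesis .
  qed
  \<comment> \<open>Nine times the optimum bound plus the bound by \<open>10 * A\<close> eliminates
    \<open>A\<close>.\<close>
  finally show ?thesis using opt by linarith
qed

lemma social_cost_connected:
  assumes "\<And>u. u \<in> P \<Longrightarrow> greedy_connected P s u"
  shows "social_cost P s = ereal (real (\<Sum>u\<in>P. card (s u)))"
  using assms by (simp add: social_cost_def agent_cost_def)

theorem mainTheorem12:
  fixes P :: "point set" and s sopt :: profile
  assumes "finite P" and "card P \<ge> 2"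
    and "nash_equilibrium P s"
    and "social_optimum P sopt"
  shows "social_cost P s \<le> ereal (18 / 10) * social_cost P sopt"
proof (cases "\<forall>u\<in>P. greedy_connected P sopt u")
  case True
  have "5 * (\<Sum>u\<in>P. card (s u)) \<le> 9 * (\<Sum>u\<in>P. card (sopt u))"
    using nash_sum_card_le assms True by (auto simp: social_optimum_def)
  then have "5 * real (\<Sum>u\<in>P. card (s u)) \<le> 9 * real (\<Sum>u\<in>P. card (sopt u))"
    by linarith
  then show ?thesis
    using social_cost_connected[of P s] social_cost_connected[of P sopt] True
      nash_greedy_connected[OF assms(3)] by simp
next
  case False
  \<comment> \<open>An unconnected agent makes the optimum infinite, so the bound is
    trivial.\<close>
  then obtain u where "u \<in> P" "agent_cost P sopt u = \<infinity>" by (auto simp: agent_cost_def)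
  then have "social_cost P sopt = \<infinity>"
    using assms(1) by (auto simp: social_cost_def sum_Pinfty)
  then show ?thesis by simp
qed

end
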